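(* Let $\mathcal{F}_1$ and $\mathcal{F}_2$ be free linkages in the plane with length ranges $[l_{11},l_{12}]$ and $[l_{21},l_{22}]$ respectively. Let $\mathcal{F}_3$ be a free linkage consisting of two edges of lengths $a$ and $b$, where $|a-b|<\max\{l_{11},l_{21}\}$ and $a+b=\min\{l_{12},l_{22}\}$. Then the moduli space $M(\mathcal{F}_1,\mathcal{F}_2,\mathcal{F}_3)$ is (homeomorphic to) the disjoint union of two copies of $M(\mathcal{F}_1,\mathcal{F}_2)$ modulo the subspace $M_\pi'$ of $M(\mathcal{F}_1,\mathcal{F}_2)$ where the angle between $a$ and $b$ is $\pi$; that is, the two copies of $M(\mathcal{F}_1,\mathcal{F}_2)$ are glued together along their copies of $M_\pi'$.
   Context: A free linkage $\mathcal{F}$ in $\mathbb{R}^2$ with length vector $(d_1,\ldots,d_n)$, $d_i>0$, has configurations $(x_1,\ldots,x_{n+1})\in(\mathbb{R}^2)^{n+1}$ with $|x_i-x_{i+1}|=d_i$ for $i=1,\ldots,n$; $x_1$ is the initial and $x_{n+1}$ the terminal vertex. For free linkages $\mathcal{F}_1,\ldots,\mathcal{F}_r$, $C(\mathcal{F}_1,\ldots,\mathcal{F}_r)$ is the space of $r$-tuples of configurations with all initial vertices at the origin and all terminal vertices coinciding, and $M(\mathcal{F}_1,\ldots,\mathcal{F}_r)=C(\mathcal{F}_1,\ldots,\mathcal{F}_r)/SO(2)$. The length range of a free linkage is the closed interval $[l_1,l_2]$, where $l_1$ is the minimum of $|x_{n+1}-x_1|$ over all its configurations and $l_2=\sum_{i=1}^n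 d_i$. The angle between $a$ and $b$ is the angle at the middle vertex of $\mathcal{F}_3$; it is $\pi$ exactly when the two edges are stretched out in a straight line. Thus $M_\pi'\subset M(\mathcal{F}_1,\mathcal{F}_2)$ consists of the configurations in which the distance between the common initial vertex and the common terminal vertex equals $a+b$. *)

theory Defs
  imports "HOL-Analysis.Analysis"
begin

section \<open>Quotient topologies\<close>

text \<open>The quotient of \<open>X\<close> by a relation \<open>R\<close>, which is meant to be an equivalence relation on
  \<open>topspace X\<close>. The points are the equivalence classes; a set of classes is open iff its preimage
  under the projection \<open>x \<mapsto> R `` {x}\<close> is open.\<close>

definition quotient_topology :: "'a topology \<Rightarrow> ('a \<times> 'a) set \<Rightarrow> 'a set topology" where
  "quotient_topology X R =
     topology (\<lambda>U. U \<subseteq> topspace X // R \<and> openin X {x \<in> topspace X. R `` {x} \<in> U})"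

lemma istopology_quotient:
  "istopology (\<lambda>U. U \<subseteq> topspace X // R \<and> openin X {x \<in> topspace X. R `` {x} \<in> U})"
proof -
  have 1: "{x \<in> topspace X. R `` {x} \<in> S \<inter> T} =
      {x \<in> topspace X. R `` {x} \<in> S} \<inter> {x \<in> topspace X. R `` {x} \<in> T}" for S T
    by auto
  have 2: "{x \<in> topspace X. R `` {x} \<in> \<Union>\<K>} = (\<Union>K\<in>\<K>. {x \<in> topspace X. R `` {x} \<in> K})" for \<K>
    by auto
  show ?thesis
    unfolding istopology_def 1 2 by (auto intro!: openin_Int)
qed

lemma openin_quotient_topology:
  "openin (quotient_topology X R) U \<longleftrightarrow>
     U \<subseteq> topspace X // R \<and> openin X {x \<in> topspace X. R `` {x} \<in> U}"
  unfolding quotient_topology_def topology_inverse'[OF istopology_quotient] ..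

lemma topspace_quotient_topology [simp]:
  "topspace (quotient_topology X R) = topspace X // R"
proof
  show "topspace (quotient_topology X R) \<subseteq> topspace X // R"
    using openin_quotient_topology[of X R] openin_topspace by blast
  have "{x \<in> topspace X. R `` {x} \<in> topspace X // R} = topspace X"
    by (auto intro: quotientI)
  then have "openin (quotient_topology X R) (topspace X // R)"
    by (simp add: openin_quotient_topology)
  then show "topspace X // R \<subseteq> topspace (quotient_topology X R)"
    by (rule openin_subset)
qed

lemma quotient_map_quotient_topology:
  "quotient_map X (quotient_topology X R) (\<lambda>x. R `` {x})"
  unfolding quotient_map_def openin_quotient_topology
  by (auto simp: quotient_def)

definition doubled_along_rel :: "'a topology \<Rightarrow> 'a set \<Rightarrow> ((bool \<times> 'a) \<times> (bool \<times> 'a)) set" where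
  "doubled_along_rel X A =
     {((s, x), (t, y)). x \<in> topspace X \<and> y = x \<and> (s = t \<or> x \<in> A)}"

lemma equiv_doubled_along_rel:
  "equiv (topspace (sum_topology (\<lambda>_. X) UNIV)) (doubled_along_rel X A)"
  by (rule equivI) (auto simp: doubled_along_rel_def refl_on_def sym_def trans_def)

text \<open>Two copies of \<open>X\<close>, glued together along their copies of \<open>A\<close>.\<close>

definition doubled_along :: "'a topology \<Rightarrow> 'a set \<Rightarrow> (bool \<times> 'a) set topology" where
  "doubled_along X A =
     quotient_topology (sum_topology (\<lambda>_. X) UNIV) (doubled_along_rel X A)"


section \<open>Free linkages and their configurations\<close>

text \<open>A free linkage is given by its length vector.\<close>

type_synonym linkage = "real list"

definition free_linkage :: "linkage \<Rightarrow> bool" where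
  "free_linkage F \<longleftrightarrow> F \<noteq> [] \<and> (\<forall>d\<in>set F. d > 0)"

text \<open>Vertices are numbered from 0, so the vertices of a linkage with \<open>n\<close> edges are
  \<open>x 0, \<dots>, x n\<close>.\<close>

definition configurations :: "linkage \<Rightarrow> (nat \<Rightarrow> real^2) set" where
  "configurations F =
     {x \<in> {..length F} \<rightarrow>\<^sub>E UNIV. \<forall>i<length F. dist (x i) (x (Suc i)) = F ! i}"

definition end_distances :: "linkage \<Rightarrow> real set" where
  "end_distances F = (\<lambda>x. dist (x (length F)) (x 0)) ` configurations F"

text \<open>The infimum below is a minimum, see \<open>Inf_end_distances_attained\<close>.\<close>

definition length_range :: "linkage \<Rightarrow> real set" where
  "length_range F = {Inf (end_distances F) .. sum_list F}"

lemma end_differences_snoc: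
  assumes "d \<ge> 0"
  shows "(\<lambda>x. x (length (F @ [d])) - x 0) ` configurations (F @ [d]) =
    (\<Union>u \<in> (\<lambda>x. x (length F) - x 0) ` configurations F. \<Union>s \<in> sphere 0 d. {u + s})"
    (is "?L = ?R")
proof (intro equalityI subsetI)
  fix v assume "v \<in> ?L"
  then obtain x where x: "x \<in> configurations (F @ [d])" "v = x (Suc (length F)) - x 0"
    by auto
  let ?y = "restrict x {..length F}"
  let ?s = "x (Suc (length F)) - x (length F)"
  have e: "dist (x i) (x (Suc i)) = (F @ [d]) ! i" if "i < Suc (length F)" for i
    using x(1) that by (simp add: configurations_def)
  have "?y \<in> configurations F"
    unfolding configurations_def using e by (auto simp: nth_append)
  moreover have "?s \<in> sphere 0 d"
    using e[of "length F"] by (simp add: dist_norm norm_minus_commute)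
  moreover have "v = (?y (length F) - ?y 0) + ?s"
    by (simp add: x)
  ultimately show "v \<in> ?R" by blast
next
  fix v assume "v \<in> ?R"
  then obtain x s where x: "x \<in> configurations F" and s: "norm s = d"
    and v: "v = x (length F) - x 0 + s"
    by auto
  let ?y = "x(Suc (length F) := x (length F) + s)"
  have "?y \<in> configurations (F @ [d])"
    using x s unfolding configurations_def
    by (auto simp: nth_append less_Suc_eq dist_norm PiE_def extensional_def)
  moreover have "v = ?y (length (F @ [d])) - ?y 0"
    by (simp add: v)
  ultimately show "v \<in> ?L" by blast
qed

lemma end_differences_compact:
  assumes "\<forall>d\<in>set F. d \<ge> 0"
  shows "compact ((\<lambda>x. x (length F) - x 0) ` configurations F) \<and> configurations F \<noteq> {}"
  using assms
proof (induction F rule: rev_induct)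
  case Nil
  have "restrict (\<lambda>_. 0) {0} \<in> configurations []"
    by (simp add: configurations_def)
  then have ne: "configurations [] \<noteq> {}"
    by blast
  then have "(\<lambda>x. x (length []) - x 0) ` configurations [] = {0}"
    by (simp add: image_constant_conv)
  then show ?case
    using ne by simp
next
  case (snoc d F)
  have d: "d \<ge> 0" and IH: "compact ((\<lambda>x. x (length F) - x 0) ` configurations F)"
    "configurations F \<noteq> {}"
    using snoc by auto
  have "sphere (0::real^2) d \<noteq> {}"
    using d by (simp add: sphere_eq_empty)
  then have "(\<lambda>x. x (length (F @ [d])) - x 0) ` configurations (F @ [d]) \<noteq> {}"
    unfolding end_differences_snoc[OF d] using IH(2) by blast
  moreover have "compact ((\<lambda>x. x (length (F @ [d])) - x 0) ` configurations (F @ [d]))"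
    unfolding end_differences_snoc[OF d] by (rule compact_sums'[OF IH(1) compact_sphere])
  ultimately show ?case by blast
qed

lemma Inf_end_distances_attained:
  assumes "free_linkage F"
  shows "Inf (end_distances F) \<in> end_distances F"
proof -
  have F: "\<forall>d\<in>set F. d \<ge> 0"
    using assms by (auto simp: free_linkage_def less_imp_le)
  have "end_distances F = norm ` ((\<lambda>x. x (length F) - x 0) ` configurations F)"
    by (simp add: end_distances_def image_image dist_norm)
  moreover have "compact (norm ` ((\<lambda>x. x (length F) - x 0) ` configurations F))"
    by (rule compact_continuous_image[OF continuous_on_norm_id])
      (rule conjunct1[OF end_differences_compact[OF F]])
  ultimately have "compact (end_distances F)" by simp
  then show ?thesis
    using end_differences_compact[OF F]
    by (intro closed_contains_Inf)
      (auto simp: end_distances_def compact_imp_closed intro!: bdd_belowI2[of _ 0])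
qed


section \<open>Moduli spaces\<close>

text \<open>For linkages \<open>Fs\<close> and a tuple of configurations \<open>c\<close>, \<open>c j i\<close> is the position of the
  \<open>i\<close>-th vertex of the \<open>j\<close>-th linkage.\<close>

definition linkage_tuples :: "linkage list \<Rightarrow> (nat \<Rightarrow> nat \<Rightarrow> real^2) set" where
  "linkage_tuples Fs =
     {c \<in> (\<Pi>\<^sub>E j\<in>{..<length Fs}. configurations (Fs ! j)).
        (\<forall>j<length Fs. c j 0 = 0) \<and>
        (\<forall>j<length Fs. \<forall>k<length Fs. c j (length (Fs ! j)) = c k (length (Fs ! k)))}"

definition configuration_space :: "linkage list \<Rightarrow> (nat \<Rightarrow> nat \<Rightarrow> real^2) topology" where
  "configuration_space Fs =
     subtopology
       (product_topology
          (\<lambda>j. product_topology (\<lambda>_. euclidean) {..length (Fs ! j)}) {..<length Fs})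
       (linkage_tuples Fs)"

lemma topspace_configuration_space [simp]:
  "topspace (configuration_space Fs) = linkage_tuples Fs"
  by (auto simp: configuration_space_def linkage_tuples_def configurations_def PiE_iff
      extensional_def)

text \<open>Two tuples are related iff they lie in the same orbit of \<open>SO(2)\<close>.\<close>

definition rotation_rel ::
  "linkage list \<Rightarrow> ((nat \<Rightarrow> nat \<Rightarrow> real^2) \<times> (nat \<Rightarrow> nat \<Rightarrow> real^2)) set" where
  "rotation_rel Fs =
     {(c, c'). c \<in> linkage_tuples Fs \<and> c' \<in> linkage_tuples Fs \<and>
        (\<exists>A :: real^2^2. rotation_matrix A \<and>
           (\<forall>j<length Fs. \<forall>i\<le>length (Fs ! j). c' j i = A *v c j i))}"

lemma equiv_rotation_rel: "equiv (linkage_tuples Fs) (rotation_rel Fs)"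
proof (rule equivI)
  show "rotation_rel Fs \<subseteq> linkage_tuples Fs \<times> linkage_tuples Fs"
    by (auto simp: rotation_rel_def)
  have "rotation_matrix (mat 1 :: real^2^2)"
    by (simp add: rotation_matrix_def orthogonal_matrix_id)
  then show "refl_on (linkage_tuples Fs) (rotation_rel Fs)"
    by (force simp: refl_on_def rotation_rel_def)
  show "sym (rotation_rel Fs)"
  proof (rule symI)
    fix c c' assume "(c, c') \<in> rotation_rel Fs"
    then obtain A :: "real^2^2" where c: "c \<in> linkage_tuples Fs" "c' \<in> linkage_tuples Fs"
      and A: "rotation_matrix A"
      and e: "\<forall>j<length Fs. \<forall>i\<le>length (Fs ! j). c' j i = A *v c j i"
      by (auto simp: rotation_rel_def)
    have "rotation_matrix (transpose A)"
      using A by (simp add: rotation_matrix_def orthogonal_matrix_transpose det_transpose)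
    moreover have "transpose A *v (A *v x) = x" for x
      using A by (simp add: matrix_vector_mul_assoc rotation_matrix_def orthogonal_matrix)
    ultimately show "(c', c) \<in> rotation_rel Fs"
      using c e by (auto simp: rotation_rel_def intro!: exI[of _ "transpose A"])
  qed
  show "trans (rotation_rel Fs)"
  proof (rule transI)
    fix c c' c'' assume "(c, c') \<in> rotation_rel Fs" "(c', c'') \<in> rotation_rel Fs"
    then obtain A B :: "real^2^2" where "c \<in> linkage_tuples Fs" "c'' \<in> linkage_tuples Fs"
      and AB: "rotation_matrix A" "rotation_matrix B"
      and "\<forall>j<length Fs. \<forall>i\<le>length (Fs ! j). c' j i = A *v c j i"
      and "\<forall>j<length Fs. \<forall>i\<le>length (Fs ! j). c'' j i = B *v c' j i"
      by (auto simp: rotation_rel_def)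
    moreover have "rotation_matrix (B ** A)"
      using AB by (simp add: rotation_matrix_def orthogonal_matrix_mul det_mul)
    ultimately show "(c, c'') \<in> rotation_rel Fs"
      by (auto simp: rotation_rel_def matrix_vector_mul_assoc intro!: exI[of _ "B ** A"])
  qed
qed

definition moduli_space :: "linkage list \<Rightarrow> (nat \<Rightarrow> nat \<Rightarrow> real^2) set topology" where
  "moduli_space Fs = quotient_topology (configuration_space Fs) (rotation_rel Fs)"

text \<open>The set \<open>M\<^sub>\<pi>'\<close> for a third linkage with edge lengths \<open>a\<close> and \<open>b\<close>: the angle between these
  edges is \<open>\<pi>\<close> iff the common end points of \<open>F\<^sub>1\<close> and \<open>F\<^sub>2\<close> are at distance \<open>a + b\<close>. Rotations
  preserve this distance, so it does not matter which representative of an orbit is used.\<close>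

definition straight_locus :: "linkage \<Rightarrow> linkage \<Rightarrow> real \<Rightarrow> real \<Rightarrow> (nat \<Rightarrow> nat \<Rightarrow> real^2) set set"
  where
  "straight_locus F1 F2 a b =
     {p \<in> topspace (moduli_space [F1, F2]). \<exists>c\<in>p. dist (c 0 (length F1)) (c 0 0) = a + b}"

end

theory Submission
  imports Defs
begin

text \<open>Put \<open>F\<^sub>1\<close> and \<open>F\<^sub>2\<close> in some position with common terminal vertex \<open>p\<close>. To add a configuration
  of the linkage with edges \<open>a, b\<close> means to choose its middle vertex, the elbow: a point \<open>u\<close> with
  \<open>|u| = a\<close> and \<open>|u - p| = b\<close>. The length ranges force \<open>|a - b| < |p| \<le> a + b\<close>, so the two circles
  meet in two points, mirror images in the line through \<open>0\<close> and \<open>p\<close>, which coincide iff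
  \<open>|p| = a + b\<close>, that is, iff the edges are stretched out. Because \<open>|p|\<close> never drops to \<open>|a - b|\<close>
  (in particular \<open>p \<noteq> 0\<close>), each of the two points has an explicit formula that is continuous in \<open>p\<close>,
  and choosing the side (left or right of \<open>p\<close>) commutes with rotations (\<open>elbow_iff\<close>,
  \<open>elbow_eq_iff\<close>, \<open>elbow_rotation\<close>).

  Hence there is a continuous map from two copies of \<open>C(F\<^sub>1, F\<^sub>2)\<close> onto \<open>C(F\<^sub>1, F\<^sub>2, F\<^sub>3)\<close>. Forgetting
  the elbow is a continuous left inverse on each copy, which makes the map closed and therefore a
  quotient map (\<open>quotient_map_attach_elbow\<close>). Both spaces to be compared are then quotients of
  the two copies of \<open>C(F\<^sub>1, F\<^sub>2)\<close>: the moduli space of all three linkages through this map followed by the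
  projection to \<open>SO(2)\<close>-orbits, the glued space by forming orbits first and gluing
  afterwards. The equivariance of the elbow shows that both identify the same points
  (\<open>rotation_rel_attach_elbow_iff\<close>), and quotient maps with the same fibres have homeomorphic
  targets (\<open>homeomorphic_space_if_same_fibres\<close>). This way no inverse map has to be written down
  on orbit spaces.

  The argument works for any nonempty list of linkages in place of \<open>F\<^sub>1, F\<^sub>2\<close>.\<close>

section \<open>Quotient maps and closed maps\<close>

text \<open>Each quotient map factors continuously through the other one.\<close>

lemma homeomorphic_space_if_same_fibres:
  assumes f: "quotient_map X Y f" and g: "quotient_map X Z g"
    and fibres: "\<And>x x'. x \<in> topspace X \<Longrightarrow> x' \<in> topspace X \<Longrightarrow> f x = f x' \<longleftrightarrow> g x = g x'"
  shows "Y homeomorphic_space Z"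
proof -
  obtain h where h: "continuous_map Y Z h" "\<And>x. x \<in> topspace X \<Longrightarrow> h (f x) = g x"
    using quotient_map_lift_exists[OF f quotient_imp_continuous_map[OF g]] fibres by metis
  obtain k where k: "continuous_map Z Y k" "\<And>x. x \<in> topspace X \<Longrightarrow> k (g x) = f x"
    using quotient_map_lift_exists[OF g quotient_imp_continuous_map[OF f]] fibres by metis
  have "homeomorphic_maps Y Z h k"
    using h k quotient_imp_surjective_map[OF f] quotient_imp_surjective_map[OF g]
    unfolding homeomorphic_maps_def by (metis imageE)
  then show ?thesis
    by (rule homeomorphic_maps_imp_homeomorphic_space)
qed

text \<open>Forming orbits separately in each copy is again a quotient map.\<close>

lemma quotient_map_sum_topology:
  assumes "\<And>i. i \<in> I \<Longrightarrow> quotient_map (X i) (Y i) (q i)"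
  shows "quotient_map (sum_topology X I) (sum_topology Y I) (\<lambda>(i, x). (i, q i x))"
  unfolding quotient_map_def
proof (intro conjI allI impI)
  have surj: "q i ` topspace (X i) = topspace (Y i)" if "i \<in> I" for i
    using assms[OF that] by (rule quotient_imp_surjective_map)
  show "(\<lambda>(i, x). (i, q i x)) ` topspace (sum_topology X I) = topspace (sum_topology Y I)"
    using surj by (force simp: image_iff)
  fix U assume U: "U \<subseteq> topspace (sum_topology Y I)"
  define V where "V = {z \<in> topspace (sum_topology X I). (case z of (i, x) \<Rightarrow> (i, q i x)) \<in> U}"
  have "openin (X i) {x. (i, x) \<in> V} \<longleftrightarrow> openin (Y i) {y. (i, y) \<in> U}" if "i \<in> I" for i
  proof -
    have "{x. (i, x) \<in> V} = {x \<in> topspace (X i). q i x \<in> {y. (i, y) \<in> U}}"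
      using that by (auto simp: V_def)
    moreover have "{y. (i, y) \<in> U} \<subseteq> topspace (Y i)"
      using U by auto
    ultimately show ?thesis
      using assms[OF that] unfolding quotient_map_def by presburger
  qed
  moreover have "V \<subseteq> Sigma I (topspace \<circ> X)"
    by (auto simp: V_def)
  ultimately have "openin (sum_topology X I) V \<longleftrightarrow> openin (sum_topology Y I) U"
    using U unfolding openin_sum_topology topspace_sum_topology by blast
  then show "openin (sum_topology X I)
      {z \<in> topspace (sum_topology X I). (case z of (i, x) \<Rightarrow> (i, q i x)) \<in> U}
    \<longleftrightarrow> openin (sum_topology Y I) U"
    by (simp only: V_def)
qed

text \<open>The image of a closed set \<open>C\<close> consists of the points of the closed set \<open>g -` C\<close> at which
  the continuous maps \<open>f \<circ> g\<close> and the identity agree.\<close>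

lemma closed_map_if_left_inverse:
  assumes f: "continuous_map X Y f" and g: "continuous_map Y X g"
    and gf: "\<And>x. x \<in> topspace X \<Longrightarrow> g (f x) = x" and Y: "Hausdorff_space Y"
  shows "closed_map X Y f"
  unfolding closed_map_def
proof (intro allI impI)
  fix C assume C: "closedin X C"
  have sub: "C \<subseteq> topspace X" "f ` topspace X \<subseteq> topspace Y"
    using C f by (auto simp: closedin_subset continuous_map_def)
  have "f ` C = {y \<in> topspace Y. g y \<in> C} \<inter> {y \<in> topspace Y. (f \<circ> g) y = id y}"
    using sub gf by (force simp: image_iff)
  moreover have "closedin Y {y \<in> topspace Y. (f \<circ> g) y = id y}"
    using Y continuous_map_compose[OF g f] continuous_map_id
    by (rule closedin_continuous_maps_eq)
  moreover have "closedin Y {y \<in> topspace Y. g y \<in> C}"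
    using g C by (rule closedin_continuous_map_preimage)
  ultimately show "closedin Y (f ` C)"
    by (simp add: closedin_Int)
qed

text \<open>A finite union of closed sets is closed, so closedness of the pieces suffices; this turns a
  finite closed cover of \<open>Y\<close> into a presentation of \<open>Y\<close> as a quotient of a disjoint union.\<close>

lemma quotient_map_from_sum_topology:
  assumes I: "finite I"
    and cont: "\<And>i. i \<in> I \<Longrightarrow> continuous_map (X i) Y (f i)"
    and closed: "\<And>i. i \<in> I \<Longrightarrow> closed_map (X i) Y (f i)"
    and cover: "topspace Y \<subseteq> (\<Union>i\<in>I. f i ` topspace (X i))"
  shows "quotient_map (sum_topology X I) Y (\<lambda>(i, x). f i x)"
proof (rule continuous_closed_imp_quotient_map)
  have into: "f i x \<in> topspace Y" if "i \<in> I" "x \<in> topspace (X i)" for i x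
    using cont[OF that(1)] that(2) by (auto simp: continuous_map_def)
  show "continuous_map (sum_topology X I) Y (\<lambda>(i, x). f i x)"
    unfolding continuous_map_def
  proof (intro conjI allI impI)
    fix U assume "openin Y U"
    then have "openin (X i) {x \<in> topspace (X i). f i x \<in> U}" if "i \<in> I" for i
      using openin_continuous_map_preimage[OF cont[OF that]] by blast
    then show "openin (sum_topology X I)
        {z \<in> topspace (sum_topology X I). (case z of (i, x) \<Rightarrow> f i x) \<in> U}"
      by (auto simp: openin_sum_topology)
  qed (use into in auto)
  show "closed_map (sum_topology X I) Y (\<lambda>(i, x). f i x)"
    unfolding closed_map_def
  proof (intro allI impI)
    fix C assume "closedin (sum_topology X I) C"
    then obtain T where T: "C = Sigma I T" "\<And>i. i \<in> I \<Longrightarrow> closedin (X i) (T i)"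
      by (auto simp: closedin_sum_topology_alt)
    have "closedin Y (\<Union>i\<in>I. f i ` T i)"
      using I T closed by (intro closedin_Union) (auto simp: closed_map_def)
    moreover have "(\<lambda>(i, x). f i x) ` C = (\<Union>i\<in>I. f i ` T i)"
      using T by force
    ultimately show "closedin Y ((\<lambda>(i, x). f i x) ` C)"
      by simp
  qed
  show "(\<lambda>(i, x). f i x) ` topspace (sum_topology X I) = topspace Y"
    using cover into by (force simp: image_iff)
qed

section \<open>Plane triangles with prescribed sides\<close>

definition quarter_turn :: "real^2 \<Rightarrow> real^2" where
  "quarter_turn p = vector [- p $ 2, p $ 1]"

lemma quarter_turn_nth [simp]: "quarter_turn p $ 1 = - p $ 2" "quarter_turn p $ 2 = p $ 1"
  by (simp_all add: quarter_turn_def)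

lemma quarter_turn_eq_0_iff [simp]: "quarter_turn p = 0 \<longleftrightarrow> p = 0"
  by (auto simp: vec_eq_iff forall_2)

lemma continuous_on_quarter_turn [continuous_intros]:
  assumes "continuous_on S f"
  shows "continuous_on S (\<lambda>x. quarter_turn (f x))"
proof -
  have "quarter_turn p = p $ 1 *\<^sub>R axis 2 1 - p $ 2 *\<^sub>R axis 1 1" for p
    by (simp add: vec_eq_iff forall_2 axis_def)
  then show ?thesis
    by (simp add: assms continuous_intros)
qed

lemma norm_vector2_sq: "(norm (v :: real^2))\<^sup>2 = (v $ 1)\<^sup>2 + (v $ 2)\<^sup>2"
  unfolding power2_norm_eq_inner by (simp add: inner_vec_def sum_2 power2_eq_square)

lemma plane_decomposition:
  assumes "p \<noteq> 0"
  shows "u = ((u \<bullet> p) / (norm p)\<^sup>2) *\<^sub>R p + ((u \<bullet> quarter_turn p) / (norm p)\<^sup>2) *\<^sub>R quarter_turn p"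
proof -
  have "(norm p)\<^sup>2 *\<^sub>R u = (u \<bullet> p) *\<^sub>R p + (u \<bullet> quarter_turn p) *\<^sub>R quarter_turn p"
    by (simp add: vec_eq_iff forall_2 norm_vector2_sq inner_vec_def sum_2)
      (simp add: power2_eq_square algebra_simps)
  then have "(1 / (norm p)\<^sup>2) *\<^sub>R (norm p)\<^sup>2 *\<^sub>R u =
      (1 / (norm p)\<^sup>2) *\<^sub>R ((u \<bullet> p) *\<^sub>R p + (u \<bullet> quarter_turn p) *\<^sub>R quarter_turn p)"
    by (rule arg_cong)
  then show ?thesis
    using assms by (simp add: scaleR_add_right)
qed

lemma norm_sq_plane_combination:
  "(norm (x *\<^sub>R p + y *\<^sub>R quarter_turn p))\<^sup>2 = (x\<^sup>2 + y\<^sup>2) * (norm p)\<^sup>2"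
  by (simp add: norm_vector2_sq) (simp add: power2_eq_square algebra_simps)

text \<open>The entries of a plane rotation satisfy \<open>A\<^sub>1\<^sub>1 = A\<^sub>2\<^sub>2\<close> and \<open>A\<^sub>1\<^sub>2 = - A\<^sub>2\<^sub>1\<close>, which is exactly
  what commuting with the quarter turn requires. A reflection would anticommute with it, so this
  is where \<open>SO(2)\<close> rather than \<open>O(2)\<close> matters.\<close>

lemma quarter_turn_rotation:
  assumes "rotation_matrix (A :: real^2^2)"
  shows "quarter_turn (A *v p) = A *v quarter_turn p"
proof -
  have col: "(A $ 1 $ 1)\<^sup>2 + (A $ 2 $ 1)\<^sup>2 = 1" "(A $ 1 $ 2)\<^sup>2 + (A $ 2 $ 2)\<^sup>2 = 1"
    and det: "A $ 1 $ 1 * A $ 2 $ 2 - A $ 1 $ 2 * A $ 2 $ 1 = 1"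
    using assms
    by (auto simp: rotation_matrix_def orthogonal_matrix matrix_matrix_mult_def transpose_def
        mat_def vec_eq_iff forall_2 sum_2 det_2 power2_eq_square)
  \<comment> \<open>Expanding, this is the sum of both columns' square norms minus twice the determinant.\<close>
  have "(A $ 1 $ 1 - A $ 2 $ 2)\<^sup>2 + (A $ 1 $ 2 + A $ 2 $ 1)\<^sup>2 = 0"
    using col det by (simp add: power2_eq_square algebra_simps)
  then have "A $ 1 $ 1 = A $ 2 $ 2" "A $ 1 $ 2 = - A $ 2 $ 1"
    by (simp_all add: sum_power2_eq_zero_iff)
  then show ?thesis
    by (simp add: vec_eq_iff forall_2 matrix_vector_mult_def sum_2)
qed

lemma norm_rotation:
  assumes "rotation_matrix (A :: real^2^2)"
  shows "norm (A *v p) = norm p"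
  using assms
  by (metis matrix_of_matrix_vector_mul matrix_vector_mul_linear orthogonal_transformation
      orthogonal_transformation_matrix rotation_matrix_def)

text \<open>For a triangle with vertices \<open>0, u, p\<close> and \<open>|p| = D\<close>, \<open>|u| = a\<close>, \<open>|u - p| = b\<close>, the law of
  cosines gives the coordinate of \<open>u\<close> along \<open>p\<close>, in units of \<open>D\<close>; Pythagoras then gives the absolute
  value of its coordinate across \<open>p\<close>. The Boolean in \<open>elbow\<close> says on which side of \<open>p\<close> the vertex
  lies.\<close>

definition elbow_along :: "real \<Rightarrow> real \<Rightarrow> real \<Rightarrow> real" where
  "elbow_along a b D = (a\<^sup>2 - b\<^sup>2 + D\<^sup>2) / (2 * D\<^sup>2)"

definition elbow_across :: "real \<Rightarrow> real \<Rightarrow> real \<Rightarrow> real" where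
  "elbow_across a b D = sqrt (a\<^sup>2 / D\<^sup>2 - (elbow_along a b D)\<^sup>2)"

definition elbow :: "real \<Rightarrow> real \<Rightarrow> bool \<Rightarrow> real^2 \<Rightarrow> real^2" where
  "elbow a b s p = elbow_along a b (norm p) *\<^sub>R p +
     (if s then elbow_across a b (norm p) else - elbow_across a b (norm p)) *\<^sub>R quarter_turn p"

text \<open>Heron's formula for the height of the triangle: the factors show its sign and zeros.\<close>

lemma elbow_height_sq:
  fixes a b D :: real
  assumes "D \<noteq> 0"
  shows "a\<^sup>2 / D\<^sup>2 - (elbow_along a b D)\<^sup>2 =
    ((a + b)\<^sup>2 - D\<^sup>2) * (D\<^sup>2 - (a - b)\<^sup>2) / (4 * (D\<^sup>2)\<^sup>2)"
  using assms by (simp add: elbow_along_def field_simps) algebra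

lemma elbow_height_nonneg:
  assumes "D \<noteq> 0" "\<bar>a - b\<bar> \<le> D" "D \<le> a + b"
  shows "0 \<le> a\<^sup>2 / D\<^sup>2 - (elbow_along a b D)\<^sup>2"
proof -
  have "D\<^sup>2 \<le> (a + b)\<^sup>2" "(a - b)\<^sup>2 \<le> D\<^sup>2"
    using assms by (auto intro!: power_mono simp: abs_le_square_iff[symmetric])
  then show ?thesis
    by (simp add: elbow_height_sq[OF assms(1)])
qed

lemma elbow_across_eq_0_iff:
  assumes "\<bar>a - b\<bar> < D" "D \<le> a + b"
  shows "elbow_across a b D = 0 \<longleftrightarrow> D = a + b"
proof -
  have "(a - b)\<^sup>2 < D\<^sup>2"
    using power_strict_mono[OF assms(1), of 2] by simp
  moreover have "(a + b)\<^sup>2 = D\<^sup>2 \<longleftrightarrow> D = a + b"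
    using assms by (simp add: power2_eq_iff_nonneg) linarith
  ultimately show ?thesis
    using assms(1) by (auto simp: elbow_across_def elbow_height_sq)
qed

text \<open>In the orthogonal frame of \<open>p\<close> and its quarter turn, the two distance conditions become one
  linear equation for the coordinate along \<open>p\<close> and one for the square of the other coordinate.\<close>

lemma elbow_iff:
  assumes "a \<ge> 0" "b \<ge> 0" "p \<noteq> 0" "\<bar>a - b\<bar> \<le> norm p" "norm p \<le> a + b"
  shows "norm u = a \<and> dist u p = b \<longleftrightarrow> (\<exists>s. u = elbow a b s p)"
proof
  let ?\<alpha> = "elbow_along a b (norm p)" and ?\<beta> = "elbow_across a b (norm p)"
  have D: "norm p \<noteq> 0"
    using assms(3) by simp
  have \<beta>: "?\<beta>\<^sup>2 = a\<^sup>2 / (norm p)\<^sup>2 - ?\<alpha>\<^sup>2"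
    unfolding elbow_across_def using elbow_height_nonneg[OF D assms(4,5)] by simp
  have \<alpha>: "?\<alpha> * (norm p)\<^sup>2 = (a\<^sup>2 - b\<^sup>2 + (norm p)\<^sup>2) / 2"
    using D by (simp add: elbow_along_def)
  have cosine: "(dist u p)\<^sup>2 = (norm u)\<^sup>2 - 2 * (u \<bullet> p) + (norm p)\<^sup>2" for u
    by (simp add: dist_norm power2_norm_eq_inner inner_diff inner_commute)
  show "\<exists>s. u = elbow a b s p" if u: "norm u = a \<and> dist u p = b"
  proof -
    define y where "y = (u \<bullet> quarter_turn p) / (norm p)\<^sup>2"
    have up: "u \<bullet> p = (a\<^sup>2 - b\<^sup>2 + (norm p)\<^sup>2) / 2"
      using cosine[of u] u by simp
    have "(u \<bullet> p) / (norm p)\<^sup>2 = ?\<alpha>"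
      by (simp add: elbow_along_def up)
    then have uy: "u = ?\<alpha> *\<^sub>R p + y *\<^sub>R quarter_turn p"
      using plane_decomposition[OF assms(3), of u] by (simp add: y_def)
    then have "a\<^sup>2 = (?\<alpha>\<^sup>2 + y\<^sup>2) * (norm p)\<^sup>2"
      using u norm_sq_plane_combination by metis
    then have "y\<^sup>2 = ?\<beta>\<^sup>2"
      using D by (simp add: \<beta>)
    then have "y = ?\<beta> \<or> y = - ?\<beta>"
      by (simp add: power2_eq_iff)
    then show ?thesis
      using uy by (metis (full_types) elbow_def)
  qed
  show "norm u = a \<and> dist u p = b" if ex: "\<exists>s. u = elbow a b s p"
  proof -
    obtain s where s: "u = elbow a b s p"
      using ex by blast
    define y where "y = (if s then ?\<beta> else - ?\<beta>)"
    have y: "y\<^sup>2 = ?\<beta>\<^sup>2" and uy: "u = ?\<alpha> *\<^sub>R p + y *\<^sub>R quarter_turn p"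
      by (simp_all add: y_def s elbow_def)
    have a: "(norm u)\<^sup>2 = a\<^sup>2"
      unfolding uy norm_sq_plane_combination using D by (simp add: y \<beta>)
    have "u \<bullet> p = ?\<alpha> * (norm p)\<^sup>2"
      by (simp add: uy norm_vector2_sq inner_vec_def sum_2) (simp add: power2_eq_square algebra_simps)
    then have "(dist u p)\<^sup>2 = b\<^sup>2"
      by (simp add: cosine a \<alpha>)
    then show ?thesis
      using a assms(1,2) by (simp add: power2_eq_iff_nonneg)
  qed
qed

lemma elbow_eq_iff:
  assumes "\<bar>a - b\<bar> < norm p" "norm p \<le> a + b"
  shows "elbow a b s p = elbow a b t p \<longleftrightarrow> s = t \<or> norm p = a + b"
proof -
  have "p \<noteq> 0"
    using assms(1) by auto
  then show ?thesis
    using elbow_across_eq_0_iff[OF assms] by (auto simp: elbow_def)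
qed

lemma elbow_rotation:
  assumes "rotation_matrix A"
  shows "elbow a b s (A *v p) = A *v elbow a b s p"
  using assms
  by (simp add: elbow_def norm_rotation quarter_turn_rotation matrix_vector_right_distrib
      matrix_vector_mult_scaleR)

lemma continuous_on_elbow: "continuous_on (- {0}) (elbow a b s)"
  unfolding elbow_def elbow_along_def elbow_across_def
  by (cases s) (auto intro!: continuous_intros)

section \<open>Tuples of configurations\<close>

text \<open>The common terminal vertex, read off from the first linkage.\<close>

definition tip :: "linkage list \<Rightarrow> (nat \<Rightarrow> nat \<Rightarrow> real^2) \<Rightarrow> real^2" where
  "tip Fs c = c 0 (length (Fs ! 0))"

lemma configurations_two_edges:
  "x \<in> configurations [a, b] \<longleftrightarrow>
     x \<in> extensional {..2} \<and> dist (x 0) (x 1) = a \<and> dist (x 1) (x 2) = b"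
  by (auto simp: configurations_def PiE_iff less_Suc_eq numeral_2_eq_2)

lemma linkage_tuples_iff_tip:
  assumes "Fs \<noteq> []"
  shows "c \<in> linkage_tuples Fs \<longleftrightarrow> c \<in> extensional {..<length Fs} \<and>
    (\<forall>j<length Fs. c j \<in> configurations (Fs ! j) \<and> c j 0 = 0 \<and> c j (length (Fs ! j)) = tip Fs c)"
proof -
  have "0 < length Fs"
    using assms by simp
  then have "(\<forall>j<length Fs. \<forall>k<length Fs. c j (length (Fs ! j)) = c k (length (Fs ! k))) \<longleftrightarrow>
      (\<forall>j<length Fs. c j (length (Fs ! j)) = tip Fs c)"
    unfolding tip_def by metis
  then show ?thesis
    by (auto simp: linkage_tuples_def PiE_iff)
qed

lemma linkage_tuples_snoc:
  assumes "Fs \<noteq> []"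
  shows "c \<in> linkage_tuples (Fs @ [F]) \<longleftrightarrow>
    c \<in> extensional {..length Fs} \<and> restrict c {..<length Fs} \<in> linkage_tuples Fs \<and>
    c (length Fs) \<in> configurations F \<and> c (length Fs) 0 = 0 \<and>
    c (length Fs) (length F) = tip Fs c"
proof -
  have "tip (Fs @ [F]) c = tip Fs c" "tip Fs (restrict c {..<length Fs}) = tip Fs c"
    using assms by (simp_all add: tip_def nth_append)
  then show ?thesis
    using assms
    by (auto simp add: linkage_tuples_iff_tip All_less_Suc nth_append lessThan_Suc_atMost)
qed

lemma continuous_map_vertex:
  assumes "j < length Gs" "i \<le> length (Gs ! j)"
  shows "continuous_map (configuration_space Gs) euclidean (\<lambda>c. c j i)"
proof -
  have "continuous_map (product_topology (\<lambda>_. euclidean) {..length (Gs ! j)}) euclidean (\<lambda>x. x i)"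
    using assms by (intro continuous_map_product_projection) auto
  moreover have "continuous_map (configuration_space Gs)
      (product_topology (\<lambda>_. euclidean) {..length (Gs ! j)}) (\<lambda>c. c j)"
    unfolding configuration_space_def using assms
    by (intro continuous_map_from_subtopology continuous_map_product_projection) auto
  ultimately show ?thesis
    by (auto dest: continuous_map_compose simp: o_def)
qed

lemma continuous_map_into_configuration_space:
  assumes into: "f \<in> topspace X \<rightarrow> linkage_tuples Gs"
    and "\<And>j i. j < length Gs \<Longrightarrow> i \<le> length (Gs ! j) \<Longrightarrow>
      continuous_map X euclidean (\<lambda>x. f x j i)"
  shows "continuous_map X (configuration_space Gs) f"
proof -
  have "f x \<in> extensional {..<length Gs}" "j < length Gs \<Longrightarrow> f x j \<in> extensional {..length (Gs ! j)}"
    if "x \<in> topspace X" for x j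
    using into that by (auto simp: linkage_tuples_def configurations_def PiE_iff Pi_iff)
  then show ?thesis
    unfolding configuration_space_def continuous_map_in_subtopology continuous_map_componentwise
    using assms by auto
qed

lemma Hausdorff_configuration_space: "Hausdorff_space (configuration_space Gs)"
  unfolding configuration_space_def
  by (intro Hausdorff_space_subtopology) (simp add: Hausdorff_space_product_topology)

lemma rotation_rel_sym: "(c, c') \<in> rotation_rel Gs \<Longrightarrow> (c', c) \<in> rotation_rel Gs"
  using equiv_rotation_rel[of Gs] by (meson equivE symE)

section \<open>Attaching an elbow to a tuple of configurations\<close>

text \<open>The new linkage gets the index \<open>length Fs\<close>, which makes it the last one in \<open>Fs @ [[a, b]]\<close>. The
  restriction to \<open>{..2}\<close> keeps the result extensional, as configurations are.\<close>

definition attach_elbow ::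
  "linkage list \<Rightarrow> real \<Rightarrow> real \<Rightarrow> bool \<Rightarrow> (nat \<Rightarrow> nat \<Rightarrow> real^2) \<Rightarrow> nat \<Rightarrow> nat \<Rightarrow> real^2" where
  "attach_elbow Fs a b s c = c(length Fs :=
     (\<lambda>i\<in>{..2}. if i = 0 then 0 else if i = 1 then elbow a b s (tip Fs c) else tip Fs c))"

text \<open>The strict inequality in \<open>reach\<close> excludes the folded position \<open>|p| = |a - b|\<close>, where the two
  elbows would coincide as well.\<close>

locale elbow_attachment =
  fixes Fs :: "linkage list" and a b :: real
  assumes nonempty: "Fs \<noteq> []" and nonneg: "0 \<le> a" "0 \<le> b"
    and reach: "\<And>c. c \<in> linkage_tuples Fs \<Longrightarrow>
      \<bar>a - b\<bar> < norm (tip Fs c) \<and> norm (tip Fs c) \<le> a + b"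
begin

lemma tip_nonzero: "c \<in> linkage_tuples Fs \<Longrightarrow> tip Fs c \<noteq> 0"
  using reach by fastforce

lemma elbow_iff_tip:
  assumes "c \<in> linkage_tuples Fs"
  shows "norm u = a \<and> dist u (tip Fs c) = b \<longleftrightarrow> (\<exists>s. u = elbow a b s (tip Fs c))"
  using reach[OF assms] tip_nonzero[OF assms] nonneg by (intro elbow_iff) auto

lemma tip_restrict [simp]: "tip Fs (restrict c {..<length Fs}) = tip Fs c"
  using nonempty by (simp add: tip_def)

lemma tip_attach_elbow [simp]: "tip Fs (attach_elbow Fs a b s c) = tip Fs c"
  using nonempty by (simp add: tip_def attach_elbow_def)

lemma restrict_attach_elbow:
  assumes "c \<in> linkage_tuples Fs"
  shows "restrict (attach_elbow Fs a b s c) {..<length Fs} = c"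
  using assms by (auto simp: attach_elbow_def linkage_tuples_def PiE_iff extensional_def)

lemma attach_elbow_in_linkage_tuples:
  assumes "c \<in> linkage_tuples Fs"
  shows "attach_elbow Fs a b s c \<in> linkage_tuples (Fs @ [[a, b]])"
proof -
  have "c \<in> extensional {..<length Fs}"
    using assms by (auto simp: linkage_tuples_def PiE_iff)
  then have "attach_elbow Fs a b s c \<in> extensional {..length Fs}"
    by (auto simp: attach_elbow_def extensional_def)
  moreover have "norm (elbow a b s (tip Fs c)) = a" "dist (elbow a b s (tip Fs c)) (tip Fs c) = b"
    using elbow_iff_tip[OF assms] by blast+
  then have "attach_elbow Fs a b s c (length Fs) \<in> configurations [a, b]"
    by (simp add: attach_elbow_def configurations_two_edges)
  ultimately show ?thesis
    using assms
    by (simp add: linkage_tuples_snoc[OF nonempty] restrict_attach_elbow)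
      (simp add: attach_elbow_def)
qed

lemma linkage_tuple_is_attach_elbow:
  assumes "c \<in> linkage_tuples (Fs @ [[a, b]])"
  obtains s where "c = attach_elbow Fs a b s (restrict c {..<length Fs})"
proof -
  let ?m = "length Fs"
  have ext: "c \<in> extensional {..?m}" and c: "restrict c {..<?m} \<in> linkage_tuples Fs"
    and conf: "c ?m \<in> configurations [a, b]" and ends: "c ?m 0 = 0" "c ?m 2 = tip Fs c"
    using assms by (auto simp: linkage_tuples_snoc[OF nonempty] numeral_2_eq_2)
  have "norm (c ?m 1) = a \<and> dist (c ?m 1) (tip Fs c) = b"
    using conf ends by (simp add: configurations_two_edges)
  then obtain s where s: "c ?m 1 = elbow a b s (tip Fs c)"
    using elbow_iff_tip[OF c] by auto
  have "c ?m i = (\<lambda>i\<in>{..2}. if i = 0 then 0 else if i = 1 then elbow a b s (tip Fs c) else tip Fs c) i"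
    for i
  proof -
    consider "i = 0" | "i = 1" | "i = 2" | "i > 2"
      by linarith
    then show ?thesis
      using conf ends s by cases (auto simp: configurations_two_edges extensional_def)
  qed
  moreover have "c j = attach_elbow Fs a b s (restrict c {..<?m}) j" if "j \<noteq> ?m" for j
    using that ext by (auto simp: attach_elbow_def extensional_def)
  ultimately have "c j = attach_elbow Fs a b s (restrict c {..<?m}) j" for j
    by (cases "j = ?m") (auto simp: attach_elbow_def)
  then show ?thesis
    using that by blast
qed

text \<open>A rotation that matches the given linkages also matches the tips, and carries the elbow on
  one side of the first tip to the elbow on the same side of the second. So it matches the attached
  elbows if the sides agree, and otherwise only if both sides give the same point.\<close>

lemma rotation_rel_attach_elbow_iff:
  assumes c: "c \<in> linkage_tuples Fs" and c': "c' \<in> linkage_tuples Fs"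
  shows "(attach_elbow Fs a b s c, attach_elbow Fs a b t c') \<in> rotation_rel (Fs @ [[a, b]]) \<longleftrightarrow>
    (c, c') \<in> rotation_rel Fs \<and> (s = t \<or> norm (tip Fs c) = a + b)"
proof -
  let ?m = "length Fs"
  have agree: "(\<forall>j<length (Fs @ [[a, b]]). \<forall>i\<le>length ((Fs @ [[a, b]]) ! j).
        attach_elbow Fs a b t c' j i = A *v attach_elbow Fs a b s c j i) \<longleftrightarrow>
      (\<forall>j<?m. \<forall>i\<le>length (Fs ! j). c' j i = A *v c j i) \<and>
      (s = t \<or> norm (tip Fs c) = a + b)" (is "?L \<longleftrightarrow> ?R")
    if A: "rotation_matrix A" for A :: "real^2^2"
  proof -
    have "?L \<longleftrightarrow> (\<forall>j<?m. \<forall>i\<le>length (Fs ! j). c' j i = A *v c j i) \<and>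
        (\<forall>i\<le>2. attach_elbow Fs a b t c' ?m i = A *v attach_elbow Fs a b s c ?m i)"
      by (auto simp: less_Suc_eq nth_append attach_elbow_def numeral_2_eq_2)
    also have "(\<forall>i\<le>2. attach_elbow Fs a b t c' ?m i = A *v attach_elbow Fs a b s c ?m i) \<longleftrightarrow>
        elbow a b t (tip Fs c') = A *v elbow a b s (tip Fs c) \<and> tip Fs c' = A *v tip Fs c"
      by (auto simp: attach_elbow_def numeral_2_eq_2 le_Suc_eq)
    also have "\<dots> \<longleftrightarrow> tip Fs c' = A *v tip Fs c \<and> (s = t \<or> norm (tip Fs c) = a + b)"
    proof (rule conj_commute[THEN trans], rule conj_cong[OF refl])
      assume tip: "tip Fs c' = A *v tip Fs c"
      have "elbow a b t (tip Fs c') = A *v elbow a b s (tip Fs c) \<longleftrightarrow>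
          elbow a b t (tip Fs c') = elbow a b s (tip Fs c')"
        by (simp add: tip elbow_rotation[OF A])
      also have "\<dots> \<longleftrightarrow> t = s \<or> norm (tip Fs c') = a + b"
        using reach[OF c'] by (simp add: elbow_eq_iff)
      finally show "elbow a b t (tip Fs c') = A *v elbow a b s (tip Fs c) \<longleftrightarrow>
          s = t \<or> norm (tip Fs c) = a + b"
        by (auto simp: tip norm_rotation[OF A])
    qed
    finally show ?thesis
      using nonempty by (auto simp: tip_def)
  qed
  have "(attach_elbow Fs a b s c, attach_elbow Fs a b t c') \<in> rotation_rel (Fs @ [[a, b]]) \<longleftrightarrow>
      (\<exists>A. rotation_matrix A \<and> (\<forall>j<length (Fs @ [[a, b]]). \<forall>i\<le>length ((Fs @ [[a, b]]) ! j).
        attach_elbow Fs a b t c' j i = A *v attach_elbow Fs a b s c j i))"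
    unfolding rotation_rel_def mem_Collect_eq prod.case
    using c c' by (simp only: attach_elbow_in_linkage_tuples simp_thms)
  also have "\<dots> \<longleftrightarrow> (\<exists>A. rotation_matrix A \<and>
      (\<forall>j<?m. \<forall>i\<le>length (Fs ! j). c' j i = A *v c j i) \<and> (s = t \<or> norm (tip Fs c) = a + b))"
    by (rule ex_cong1, rule conj_cong[OF refl agree])
  also have "\<dots> \<longleftrightarrow> (c, c') \<in> rotation_rel Fs \<and> (s = t \<or> norm (tip Fs c) = a + b)"
    using c c' unfolding rotation_rel_def by blast
  finally show ?thesis .
qed

lemma continuous_map_attach_elbow:
  "continuous_map (configuration_space Fs) (configuration_space (Fs @ [[a, b]]))
     (attach_elbow Fs a b s)"
proof (rule continuous_map_into_configuration_space)
  show "attach_elbow Fs a b s \<in> topspace (configuration_space Fs) \<rightarrow> linkage_tuples (Fs @ [[a, b]])"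
    using attach_elbow_in_linkage_tuples by auto
  fix j i assume ji: "j < length (Fs @ [[a, b]])" "i \<le> length ((Fs @ [[a, b]]) ! j)"
  have tip: "continuous_map (configuration_space Fs) euclidean (tip Fs)"
    unfolding tip_def using nonempty by (intro continuous_map_vertex) auto
  then have "continuous_map (configuration_space Fs) (top_of_set (- {0})) (tip Fs)"
    using tip_nonzero by (auto simp: continuous_map_in_subtopology)
  then have elbow: "continuous_map (configuration_space Fs) euclidean (\<lambda>c. elbow a b s (tip Fs c))"
    using continuous_on_elbow[of a b s] continuous_map_compose[of _ _ "tip Fs" _ "elbow a b s"]
    by (simp add: o_def)
  show "continuous_map (configuration_space Fs) euclidean (\<lambda>c. attach_elbow Fs a b s c j i)"
  proof (cases "j < length Fs")
    case True
    then show ?thesis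
      using ji continuous_map_vertex[of j Fs i] by (simp add: attach_elbow_def nth_append)
  next
    case False
    then have "j = length Fs" "i \<le> 2"
      using ji by (auto simp: nth_append)
    then show ?thesis
      using tip elbow by (simp add: attach_elbow_def)
  qed
qed

lemma continuous_map_forget_last:
  "continuous_map (configuration_space (Fs @ [F])) (configuration_space Fs)
     (\<lambda>c. restrict c {..<length Fs})"
proof (rule continuous_map_into_configuration_space)
  fix j i assume "j < length Fs" "i \<le> length (Fs ! j)"
  then show "continuous_map (configuration_space (Fs @ [F])) euclidean
      (\<lambda>c. restrict c {..<length Fs} j i)"
    using continuous_map_vertex[of j "Fs @ [F]" i] by (simp add: nth_append)
qed (simp add: linkage_tuples_snoc[OF nonempty])

text \<open>Restriction to the old linkages is a continuous left inverse on either copy, and together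
  the copies cover everything because there are no elbows other than the two.\<close>

lemma quotient_map_attach_elbow:
  "quotient_map (sum_topology (\<lambda>_. configuration_space Fs) UNIV)
     (configuration_space (Fs @ [[a, b]])) (\<lambda>(s, c). attach_elbow Fs a b s c)"
proof (rule quotient_map_from_sum_topology)
  show "closed_map (configuration_space Fs) (configuration_space (Fs @ [[a, b]]))
      (attach_elbow Fs a b s)" for s
    using continuous_map_attach_elbow continuous_map_forget_last _ Hausdorff_configuration_space
    by (rule closed_map_if_left_inverse) (simp add: restrict_attach_elbow)
  show "topspace (configuration_space (Fs @ [[a, b]]))
      \<subseteq> (\<Union>s\<in>UNIV. attach_elbow Fs a b s ` topspace (configuration_space Fs))"
  proof
    fix c assume "c \<in> topspace (configuration_space (Fs @ [[a, b]]))"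
    then have c: "c \<in> linkage_tuples (Fs @ [[a, b]])"
      by simp
    then have "restrict c {..<length Fs} \<in> linkage_tuples Fs"
      by (simp add: linkage_tuples_snoc[OF nonempty])
    then show "c \<in> (\<Union>s\<in>UNIV. attach_elbow Fs a b s ` topspace (configuration_space Fs))"
      using linkage_tuple_is_attach_elbow[OF c]
      by (metis UN_iff UNIV_I imageI topspace_configuration_space)
  qed
qed (simp_all add: continuous_map_attach_elbow)

definition stretched :: "(nat \<Rightarrow> nat \<Rightarrow> real^2) set set" where
  "stretched = {p \<in> topspace (moduli_space Fs). \<exists>c\<in>p. norm (tip Fs c) = a + b}"

text \<open>Rotations preserve the norm of the tip, so any representative decides membership.\<close>

lemma class_in_stretched_iff:
  assumes c: "c \<in> linkage_tuples Fs"
  shows "rotation_rel Fs `` {c} \<in> stretched \<longleftrightarrow> norm (tip Fs c) = a + b"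
proof -
  have M: "rotation_rel Fs `` {c} \<in> topspace (moduli_space Fs)"
    using c by (simp add: moduli_space_def quotientI)
  have "norm (tip Fs c') = norm (tip Fs c)" if rel: "(c, c') \<in> rotation_rel Fs" for c'
  proof -
    obtain A where "rotation_matrix A" "tip Fs c' = A *v tip Fs c"
      using rel nonempty unfolding rotation_rel_def tip_def by blast
    then show ?thesis
      by (simp add: norm_rotation)
  qed
  moreover have "(c, c) \<in> rotation_rel Fs"
    using c equiv_rotation_rel by (auto simp: equiv_def refl_on_def)
  ultimately have "(\<exists>c'\<in>rotation_rel Fs `` {c}. norm (tip Fs c') = a + b) \<longleftrightarrow> norm (tip Fs c) = a + b"
    by (metis Image_singleton_iff)
  then show ?thesis
    using M by (simp add: stretched_def)
qed

theorem moduli_space_attach_elbow: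
  "moduli_space (Fs @ [[a, b]]) homeomorphic_space doubled_along (moduli_space Fs) stretched"
proof -
  let ?X = "configuration_space Fs" and ?M = "moduli_space Fs"
  let ?S = "sum_topology (\<lambda>_. ?X) (UNIV :: bool set)"
  let ?R = "rotation_rel (Fs @ [[a, b]])"
  let ?D = "doubled_along_rel ?M stretched"
  \<comment> \<open>\<open>f\<close> attaches the elbow and then forms the orbit; \<open>g\<close> forms the orbit and then glues.\<close>
  define f where "f = (\<lambda>(s, c). ?R `` {attach_elbow Fs a b s c})"
  define g where "g = (\<lambda>(s, c). ?D `` {(s, rotation_rel Fs `` {c})})"
  have f: "quotient_map ?S (moduli_space (Fs @ [[a, b]])) f"
  proof -
    have "f = (\<lambda>c. ?R `` {c}) \<circ> (\<lambda>(s, c). attach_elbow Fs a b s c)"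
      by (auto simp: f_def fun_eq_iff)
    then show ?thesis
      unfolding moduli_space_def
      using quotient_map_compose[OF quotient_map_attach_elbow quotient_map_quotient_topology]
      by simp
  qed
  have g: "quotient_map ?S (doubled_along ?M stretched) g"
  proof -
    have "quotient_map ?S (sum_topology (\<lambda>_. ?M) UNIV) (\<lambda>(s, c). (s, rotation_rel Fs `` {c}))"
      unfolding moduli_space_def
      by (intro quotient_map_sum_topology quotient_map_quotient_topology)
    from quotient_map_compose[OF this quotient_map_quotient_topology]
    have "quotient_map ?S (doubled_along ?M stretched)
        ((\<lambda>z. ?D `` {z}) \<circ> (\<lambda>(s, c). (s, rotation_rel Fs `` {c})))"
      unfolding doubled_along_def .
    moreover have "g = (\<lambda>z. ?D `` {z}) \<circ> (\<lambda>(s, c). (s, rotation_rel Fs `` {c}))"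
      by (auto simp: g_def fun_eq_iff)
    ultimately show ?thesis
      by simp
  qed
  have fibres: "f z = f z' \<longleftrightarrow> g z = g z'" if "z \<in> topspace ?S" "z' \<in> topspace ?S" for z z'
  proof -
    obtain s c t c' where z: "z = (s, c)" "z' = (t, c')"
      by (metis surj_pair)
    have c: "c \<in> linkage_tuples Fs" "c' \<in> linkage_tuples Fs"
      using that z by auto
    have M: "rotation_rel Fs `` {c} \<in> topspace ?M" "rotation_rel Fs `` {c'} \<in> topspace ?M"
      using c by (simp_all add: moduli_space_def quotientI)
    have "f z = f z' \<longleftrightarrow> (attach_elbow Fs a b s c, attach_elbow Fs a b t c') \<in> ?R"
      using c by (simp add: f_def z attach_elbow_in_linkage_tuples
          eq_equiv_class_iff[OF equiv_rotation_rel])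
    also have "\<dots> \<longleftrightarrow> (c, c') \<in> rotation_rel Fs \<and> (s = t \<or> norm (tip Fs c) = a + b)"
      by (rule rotation_rel_attach_elbow_iff[OF c])
    also have "\<dots> \<longleftrightarrow> rotation_rel Fs `` {c'} = rotation_rel Fs `` {c} \<and>
        (s = t \<or> rotation_rel Fs `` {c} \<in> stretched)"
      using c by (auto simp: eq_equiv_class_iff[OF equiv_rotation_rel] class_in_stretched_iff
          dest: rotation_rel_sym)
    also have "\<dots> \<longleftrightarrow> ((s, rotation_rel Fs `` {c}), (t, rotation_rel Fs `` {c'})) \<in> ?D"
      using M by (simp add: doubled_along_rel_def)
    also have "\<dots> \<longleftrightarrow> g z = g z'"
      using M by (simp add: g_def z eq_equiv_class_iff[OF equiv_doubled_along_rel])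
    finally show ?thesis .
  qed
  show ?thesis
    using f g fibres by (rule homeomorphic_space_if_same_fibres)
qed

end

section \<open>Two linkages joined by an elbow\<close>

lemma dist_ends_bounds:
  assumes "x \<in> configurations F"
  shows "Inf (end_distances F) \<le> dist (x (length F)) (x 0)" "dist (x (length F)) (x 0) \<le> sum_list F"
proof -
  have "bdd_below (end_distances F)"
    by (auto simp: end_distances_def intro!: bdd_belowI2[of _ 0])
  then show "Inf (end_distances F) \<le> dist (x (length F)) (x 0)"
    using assms by (intro cInf_lower) (auto simp: end_distances_def)
  have "dist (x k) (x 0) \<le> sum_list (take k F)" if "k \<le> length F" for k
    using that
  proof (induction k)
    case (Suc k)
    have "dist (x k) (x (Suc k)) = F ! k"
      using assms Suc.prems by (simp add: configurations_def)
    then show ?case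
      using Suc dist_triangle[of "x (Suc k)" "x 0" "x k"]
      by (simp add: take_Suc_conv_app_nth dist_commute)
  qed simp
  from this[of "length F"] show "dist (x (length F)) (x 0) \<le> sum_list F"
    by simp
qed

text \<open>An equality of closed intervals determines the end points only if the intervals are
  nonempty; here this follows from the existence of a configuration.\<close>

lemma length_range_eqD:
  assumes "free_linkage F" "length_range F = {l..u}"
  shows "l = Inf (end_distances F)" "u = sum_list F"
proof -
  have "Inf (end_distances F) \<le> sum_list F"
    using Inf_end_distances_attained[OF assms(1)] dist_ends_bounds(2)
    unfolding end_distances_def by auto
  then show "l = Inf (end_distances F)" "u = sum_list F"
    using assms(2) unfolding length_range_def by (auto simp: Icc_eq_Icc)
qed

theorem proposition5p11:
  fixes F1 F2 :: linkage and l11 l12 l21 l22 a b :: real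
  assumes "free_linkage F1" and "free_linkage F2" and "free_linkage [a, b]"
    and "length_range F1 = {l11..l12}" and "length_range F2 = {l21..l22}"
    and "\<bar>a - b\<bar> < max l11 l21" and "a + b = min l12 l22"
  shows "moduli_space [F1, F2, [a, b]] homeomorphic_space
    doubled_along (moduli_space [F1, F2]) (straight_locus F1 F2 a b)"
proof -
  interpret elbow_attachment "[F1, F2]" a b
  proof
    show "0 \<le> a" "0 \<le> b"
      using assms(3) by (auto simp: free_linkage_def)
    fix c assume c: "c \<in> linkage_tuples [F1, F2]"
    have conf: "c 0 \<in> configurations F1" "c 1 \<in> configurations F2"
      and ends: "c 0 0 = 0" "c 1 0 = 0" "c 1 (length F2) = c 0 (length F1)"
      using c by (simp_all add: linkage_tuples_iff_tip tip_def All_less_Suc)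
    show "\<bar>a - b\<bar> < norm (tip [F1, F2] c) \<and> norm (tip [F1, F2] c) \<le> a + b"
      using dist_ends_bounds[OF conf(1)] dist_ends_bounds[OF conf(2)] ends assms(6,7)
      by (simp add: tip_def length_range_eqD[OF assms(1,4)] length_range_eqD[OF assms(2,5)])
  qed simp
  have "norm (tip [F1, F2] c) = dist (c 0 (length F1)) (c 0 0)"
    if "p \<in> topspace (moduli_space [F1, F2])" "c \<in> p" for p c
  proof -
    have "c \<in> linkage_tuples [F1, F2]"
      using that in_quotient_imp_subset[OF equiv_rotation_rel] by (auto simp: moduli_space_def)
    then have "c 0 0 = 0"
      by (simp add: linkage_tuples_def)
    then show ?thesis
      by (simp add: tip_def)
  qed
  then have "stretched = straight_locus F1 F2 a b"
    by (auto simp: stretched_def straight_locus_def)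
  then show ?thesis
    using moduli_space_attach_elbow by simp
qed

end
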